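(* If $f(z)=z+\sum_{n=2}^{\infty}a_nz^n\in \mathcal{S}_{S,e}^*$, then $$|H_{2,2}(f^{-1})|=|A_2A_4-A_3^2|\leq\frac{1}{4}.$$ The inequality is sharp.
   Context: $\mathbb{D}=\{z\in\mathbb{C}:|z|<1\}$. $\mathcal{S}$ is the class of univalent (injective) analytic functions $f$ on $\mathbb{D}$ with expansion $f(z)=z+\sum_{n\ge 2}a_nz^n$. For analytic $g,h$ on $\mathbb{D}$, $g\prec h$ (subordination) means $g=h\circ w$ for some analytic $w:\mathbb{D}\to\mathbb{D}$ with $w(0)=0$. The class is $$\mathcal{S}_{S,e}^*=\left\{f\in\mathcal{S}:\ \frac{2zf'(z)}{f(z)-f(-z)}\prec e^z\right\}.$$ For $f\in\mathcal{S}$, the inverse function near $0$ is $f^{-1}(w)=w+A_2w^2+A_3w^3+A_4w^4+\cdots$, and $H_{2,2}(f^{-1}):=A_2A_4-A_3^2$. "Sharp" means that equality is attained by some function in the class. *)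

theory Defs
  imports "HOL-Complex_Analysis.Complex_Analysis"
begin

abbreviation unit_disc :: "complex set" ("\<D>") where
  "\<D> \<equiv> ball 0 1"

(* For f holomorphic on the disc, the expansion f(z) = z + a_2 z^2 + ... says f(0) = 0 and f'(0) = 1. *)
definition class_S :: "(complex \<Rightarrow> complex) set" where
  "class_S = {f. f holomorphic_on \<D> \<and> inj_on f \<D> \<and> f 0 = 0 \<and> deriv f 0 = 1}"

definition subordinate :: "(complex \<Rightarrow> complex) \<Rightarrow> (complex \<Rightarrow> complex) \<Rightarrow> bool"
    (infix "\<prec>\<^sub>s" 50) where
  "g \<prec>\<^sub>s h \<longleftrightarrow> g holomorphic_on \<D> \<and> h holomorphic_on \<D> \<and>
     (\<exists>w. w holomorphic_on \<D> \<and> w \<in> \<D> \<rightarrow> \<D> \<and> w 0 = 0 \<and> (\<forall>z\<in>\<D>. g z = h (w z)))"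

(* The quotient 2 z f'(z) / (f(z) - f(-z)).  For f in class_S its only singularity in the disc
   is the removable one at 0, where the limit is 1; HOL division would give 0 there. *)
definition sym_quotient :: "(complex \<Rightarrow> complex) \<Rightarrow> complex \<Rightarrow> complex" where
  "sym_quotient f z = (if z = 0 then 1 else 2 * z * deriv f z / (f z - f (- z)))"

definition class_SSe :: "(complex \<Rightarrow> complex) set" where
  "class_SSe = {f \<in> class_S. sym_quotient f \<prec>\<^sub>s exp}"

definition inverse_on_disc :: "(complex \<Rightarrow> complex) \<Rightarrow> complex \<Rightarrow> complex" where
  "inverse_on_disc f = the_inv_into \<D> f"

definition taylor_coeff :: "(complex \<Rightarrow> complex) \<Rightarrow> nat \<Rightarrow> complex" where
  "taylor_coeff g n = fps_nth (fps_expansion g 0) n"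

definition H22 :: "(complex \<Rightarrow> complex) \<Rightarrow> complex" where
  "H22 g = taylor_coeff g 2 * taylor_coeff g 4 - (taylor_coeff g 3)\<^sup>2"

end

theory Submission
  imports Defs
begin

text \<open>
  Write the subordination as \<open>2 z f'(z) / (f(z) - f(-z)) = exp (w(z))\<close> with a Schwarz function
  \<open>w(z) = c\<^sub>1 z + c\<^sub>2 z^2 + c\<^sub>3 z^3 + \<dots>\<close>. Comparing coefficients expresses the Hankel determinant
  of the inverse as \<open>- c\<^sub>1^4/96 - 3 c\<^sub>1^2 c\<^sub>2/16 + c\<^sub>1 c\<^sub>3/8 - c\<^sub>2^2/4\<close>. Three steps of the Schur
  algorithm parametrise \<open>c\<^sub>2\<close> and \<open>c\<^sub>3\<close> by numbers \<open>x\<close>, \<open>y\<close> of the closed unit disc; the resulting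
  triangle-inequality bound increases with \<open>|x|\<close>, and for \<open>|x| = 1\<close> it is at most \<open>1/4\<close>.
  Equality holds for \<open>w(z) = z^2\<close>, that is for \<open>f(z) = z exp (h(z))\<close> with
  \<open>h'(z) = (exp (z^2) - 1) / z\<close>. This \<open>f\<close> is univalent because in the logarithmic coordinate
  \<open>z = exp s\<close> it becomes \<open>L(s) = s + h(exp s)\<close>, whose derivative \<open>exp (exp (2 s))\<close> has positive real part
  on the convex half plane \<open>Re s < 0\<close>.
\<close>

section \<open>The Schur algorithm and the first coefficients of a Schwarz function\<close>

text \<open>Moving \<open>\<phi> 0\<close> to 0 by a disc automorphism gives a Schwarz function, and
  the Schwarz lemma bounds its quotient \<open>k\<close> by \<open>z\<close>. The relation is the
  inverse automorphism cleared of its denominator, so it passes to power series and also covers a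
  unimodular constant, with \<open>k = 0\<close>. The bounds are non-strict so that the step can be
  iterated.\<close>

lemma schur_step:
  assumes hol: "\<phi> holomorphic_on \<D>" and le: "\<And>z. z \<in> \<D> \<Longrightarrow> cmod (\<phi> z) \<le> 1"
  obtains k where "k holomorphic_on \<D>" "\<And>z. z \<in> \<D> \<Longrightarrow> cmod (k z) \<le> 1"
    "\<And>z. z \<in> \<D> \<Longrightarrow> \<phi> z * (1 + cnj (\<phi> 0) * z * k z) = \<phi> 0 + z * k z"
proof (cases "\<exists>\<xi>\<in>\<D>. cmod (\<phi> \<xi>) = 1")
  case True
  then obtain \<xi> where "\<xi> \<in> \<D>" "cmod (\<phi> \<xi>) = 1" by blast
  then have "\<phi> constant_on \<D>"
    using hol le by (intro maximum_modulus_principle[where U = \<D> and \<xi> = \<xi>]) auto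
  then obtain c where "\<phi> z = c" if "z \<in> \<D>" for z
    unfolding constant_on_def by blast
  then show ?thesis
    by (intro that[of "\<lambda>_. 0"]) auto
next
  case False
  then have lt: "cmod (\<phi> z) < 1" if "z \<in> \<D>" for z
    using le[OF that] that by force
  define a where "a = \<phi> 0"
  define \<psi> where "\<psi> = Moebius_function 0 a \<circ> \<phi>"
  have a: "cmod a < 1"
    using lt by (simp add: a_def)
  have \<psi>_hol: "\<psi> holomorphic_on \<D>"
    unfolding \<psi>_def using lt
    by (intro holomorphic_on_compose_gen[OF hol Moebius_function_holomorphic[OF a]]) auto
  have \<psi>_0: "\<psi> 0 = 0"
    by (simp add: \<psi>_def a_def Moebius_function_eq_zero)
  have \<psi>_lt: "cmod (\<psi> z) < 1" if "cmod z < 1" for z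
    using Moebius_function_norm_lt_1[OF a] lt that by (simp add: \<psi>_def)
  obtain k where k: "k holomorphic_on \<D>" "\<And>z. cmod z < 1 \<Longrightarrow> \<psi> z = z * k z" "deriv \<psi> 0 = k 0"
    using Schwarz3[OF \<psi>_hol \<psi>_0] by blast
  show ?thesis
  proof (rule that)
    show "k holomorphic_on \<D>" by fact
    fix z assume z: "z \<in> \<D>"
    show "cmod (k z) \<le> 1"
    \<comment> \<open>At the origin \<open>k 0\<close> is the derivative of \<open>\<psi>\<close>,
      which the Schwarz lemma bounds separately.\<close>
    proof (cases "z = 0")
      case True
      then show ?thesis
        using Schwarz_Lemma(2)[OF \<psi>_hol \<psi>_0 \<psi>_lt, of 0] k(3) by simp
    next
      case False
      then show ?thesis
        using Schwarz_Lemma(1)[OF \<psi>_hol \<psi>_0 \<psi>_lt, of z] k(2)[of z] z by (simp add: norm_mult)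
    qed
    have "cmod (cnj a * \<phi> z) < 1"
      using norm_mult_less[of "cnj a" 1 "\<phi> z" 1] a lt[OF z] by simp
    then have "1 - cnj a * \<phi> z \<noteq> 0"
      by auto
    moreover have "z * k z = (\<phi> z - a) / (1 - cnj a * \<phi> z)"
      using k(2)[of z] z by (simp add: \<psi>_def Moebius_function_simple)
    ultimately have "z * k z * (1 - cnj a * \<phi> z) = \<phi> z - a"
      by simp
    then show "\<phi> z * (1 + cnj (\<phi> 0) * z * k z) = \<phi> 0 + z * k z"
      unfolding a_def by (simp add: algebra_simps)
  qed
qed

lemma fps_expansion_disc:
  assumes "f holomorphic_on \<D>"
  shows "f has_fps_expansion fps_expansion f 0"
  using assms by (intro has_fps_expansion_fps_expansion[of \<D>]) auto

lemma fps_eqI_disc: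
  assumes "f has_fps_expansion F" "g has_fps_expansion G" "\<And>z. z \<in> \<D> \<Longrightarrow> f z = g z"
  shows "F = G"
proof -
  have "eventually (\<lambda>z. f z = g z) (nhds 0)"
    using assms(3) by (intro eventually_nhds_in_open[of \<D> 0, THEN eventually_mono]) auto
  then have "g has_fps_expansion F"
    using assms(1) has_fps_expansion_cong by blast
  then show ?thesis
    using assms(2) fps_expansion_unique_complex by blast
qed

lemma schur_step_fps:
  assumes hol: "\<phi> holomorphic_on \<D>" and le: "\<And>z. z \<in> \<D> \<Longrightarrow> cmod (\<phi> z) \<le> 1"
    and F: "\<phi> has_fps_expansion F"
  obtains k G where "k holomorphic_on \<D>" "\<And>z. z \<in> \<D> \<Longrightarrow> cmod (k z) \<le> 1" "k has_fps_expansion G"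
    "F * (1 + fps_const (cnj (fps_nth F 0)) * fps_X * G) = fps_const (fps_nth F 0) + fps_X * G"
proof -
  obtain k where k: "k holomorphic_on \<D>" "\<And>z. z \<in> \<D> \<Longrightarrow> cmod (k z) \<le> 1"
    "\<And>z. z \<in> \<D> \<Longrightarrow> \<phi> z * (1 + cnj (\<phi> 0) * z * k z) = \<phi> 0 + z * k z"
    using schur_step[OF hol le] by metis
  have F0: "\<phi> 0 = fps_nth F 0"
    using has_fps_expansion_imp_0_eq_fps_nth_0[OF F] by simp
  note G = fps_expansion_disc[OF k(1)]
  have "F * (1 + fps_const (cnj (fps_nth F 0)) * fps_X * fps_expansion k 0)
      = fps_const (fps_nth F 0) + fps_X * fps_expansion k 0"
    using k(3) unfolding F0
    by (intro fps_eqI_disc[of "\<lambda>z. \<phi> z * (1 + cnj (fps_nth F 0) * z * k z)" _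
          "\<lambda>z. fps_nth F 0 + z * k z"] fps_expansion_intros F G)
  then show ?thesis
    using that k(1,2) G by blast
qed

text \<open>Three Schur steps are applied to \<open>w\<close>; \<open>x\<close> and \<open>y\<close>
  are the values at 0 of the second and third quotients, and the coefficients of \<open>w\<close>
  follow by comparing power series up to order two.\<close>

lemma schur_coeffs:
  assumes w: "w holomorphic_on \<D>" "w \<in> \<D> \<rightarrow> \<D>" "w 0 = 0" and F: "w has_fps_expansion F"
  obtains x y where "cmod (fps_nth F 1) \<le> 1" "cmod x \<le> 1" "cmod y \<le> 1"
    "fps_nth F 2 = (1 - fps_nth F 1 * cnj (fps_nth F 1)) * x"
    "fps_nth F 3 = (1 - fps_nth F 1 * cnj (fps_nth F 1)) * ((1 - x * cnj x) * y - cnj (fps_nth F 1) * x\<^sup>2)"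
proof -
  have F0: "fps_nth F 0 = 0"
    using has_fps_expansion_imp_0_eq_fps_nth_0[OF F] w(3) by simp
  have "cmod (w z) \<le> 1" if "z \<in> \<D>" for z
    using w(2) that by (force simp: Pi_iff)
  \<comment> \<open>As \<open>w 0 = 0\<close>, the first step is plain division by \<open>z\<close>;
    hence the index shift by one in \<open>c\<close> below.\<close>
  from schur_step_fps[OF w(1) this F] obtain \<phi> \<Phi> where 1: "\<phi> holomorphic_on \<D>"
    "\<And>z. z \<in> \<D> \<Longrightarrow> cmod (\<phi> z) \<le> 1" "\<phi> has_fps_expansion \<Phi>" and F_eq: "F = fps_X * \<Phi>"
    by (auto simp: F0)
  from schur_step_fps[OF 1] obtain k K where 2: "k holomorphic_on \<D>"
    "\<And>z. z \<in> \<D> \<Longrightarrow> cmod (k z) \<le> 1" "k has_fps_expansion K"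
    and \<Phi>_eq: "\<Phi> * (1 + fps_const (cnj (fps_nth \<Phi> 0)) * fps_X * K) = fps_const (fps_nth \<Phi> 0) + fps_X * K"
    by blast
  from schur_step_fps[OF 2] obtain \<theta> \<Theta> where 3: "\<theta> holomorphic_on \<D>"
    "\<And>z. z \<in> \<D> \<Longrightarrow> cmod (\<theta> z) \<le> 1" "\<theta> has_fps_expansion \<Theta>"
    and K_eq: "K * (1 + fps_const (cnj (fps_nth K 0)) * fps_X * \<Theta>) = fps_const (fps_nth K 0) + fps_X * \<Theta>"
    by blast
  have c: "fps_nth F 1 = fps_nth \<Phi> 0" "fps_nth F 2 = fps_nth \<Phi> 1" "fps_nth F 3 = fps_nth \<Phi> 2"
    by (simp_all add: F_eq)
  have nth_eq: "\<And>n. fps_nth A n = fps_nth B n" if "A = B" for A B :: "complex fps"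
    using that by simp
  have K1: "fps_nth K 1 = (1 - fps_nth K 0 * cnj (fps_nth K 0)) * fps_nth \<Theta> 0"
    using nth_eq[OF K_eq, of 1] by (simp add: fps_mult_nth algebra_simps)
  have \<Phi>1: "fps_nth \<Phi> 1 = (1 - fps_nth \<Phi> 0 * cnj (fps_nth \<Phi> 0)) * fps_nth K 0"
    using nth_eq[OF \<Phi>_eq, of 1] by (simp add: fps_mult_nth algebra_simps)
  have \<Phi>2: "fps_nth \<Phi> 2 = (1 - fps_nth \<Phi> 0 * cnj (fps_nth \<Phi> 0)) * fps_nth K 1
      - fps_nth \<Phi> 1 * cnj (fps_nth \<Phi> 0) * fps_nth K 0"
    using nth_eq[OF \<Phi>_eq, of 2] by (simp add: fps_mult_nth eval_nat_numeral algebra_simps)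
  show ?thesis
  proof (rule that)
    show "cmod (fps_nth F 1) \<le> 1" "cmod (fps_nth K 0) \<le> 1" "cmod (fps_nth \<Theta> 0) \<le> 1"
      unfolding c using 1 2 3 has_fps_expansion_imp_0_eq_fps_nth_0 by (metis centre_in_ball zero_less_one)+
    show "fps_nth F 2 = (1 - fps_nth F 1 * cnj (fps_nth F 1)) * fps_nth K 0"
      unfolding c by (rule \<Phi>1)
    show "fps_nth F 3 = (1 - fps_nth F 1 * cnj (fps_nth F 1))
        * ((1 - fps_nth K 0 * cnj (fps_nth K 0)) * fps_nth \<Theta> 0 - cnj (fps_nth F 1) * (fps_nth K 0)\<^sup>2)"
      unfolding c \<Phi>2 \<Phi>1 K1 by (simp add: algebra_simps power2_eq_square)
  qed
qed

section \<open>The inequality in the Schur parameters\<close>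

lemma schur_parameter_bound:
  fixes c r :: real
  assumes "0 \<le> c" "c \<le> 1" "0 \<le> r" "r \<le> 1"
  shows "c ^ 4 / 96 + 3/16 * c\<^sup>2 * ((1 - c\<^sup>2) * r) + c * (1 - c\<^sup>2) * (1 - r\<^sup>2) / 8
    + c\<^sup>2 * (1 - c\<^sup>2) * r\<^sup>2 / 8 + (1 - c\<^sup>2)\<^sup>2 * r\<^sup>2 / 4 \<le> 1/4" (is "?L \<le> _")
proof -
  define d where "d = 1 - c\<^sup>2"
  have d: "0 \<le> d" using assms by (simp add: d_def power_le_one)
  \<comment> \<open>Expansion around \<open>r = 1\<close>: the \<open>r\<^sup>2\<close> terms
    combine through \<open>2 - c - c\<^sup>2 = (1 - c) * (2 + c)\<close>, so both corrections are
    visibly nonpositive.\<close>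
  have "?L = c ^ 4 / 96 + 3/16 * c\<^sup>2 * d + d * (2 - c\<^sup>2) / 8
      - 3/16 * c\<^sup>2 * d * (1 - r) - d * (1 - c) * (2 + c) * (1 - r\<^sup>2) / 8"
    unfolding d_def by (simp add: field_simps power2_eq_square power4_eq_xxxx)
  also have "\<dots> \<le> c ^ 4 / 96 + 3/16 * c\<^sup>2 * d + d * (2 - c\<^sup>2) / 8"
  proof -
    have "0 \<le> c\<^sup>2 * d * (1 - r)" "0 \<le> d * (1 - c) * (2 + c) * (1 - r\<^sup>2)"
      using assms d by (auto intro!: mult_nonneg_nonneg simp: power_le_one)
    then show ?thesis by linarith
  qed
  also have "\<dots> = 1/4 - 3 * c\<^sup>2 / 16 - 5 * c ^ 4 / 96"
    unfolding d_def by (simp add: field_simps power2_eq_square power4_eq_xxxx)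
  also have "\<dots> \<le> 1/4"
  proof -
    have "0 \<le> c\<^sup>2" "0 \<le> c ^ 4" by simp_all
    then show ?thesis by linarith
  qed
  finally show ?thesis .
qed

text \<open>After substitution the modulus of each summand depends only on \<open>cmod c1\<close>,
  \<open>cmod x\<close> and \<open>cmod y\<close>, and \<open>y\<close> occurs in \<open>t3\<close>
  alone. The triangle inequality loses nothing at \<open>c1 = 0\<close>, \<open>cmod x = 1\<close>,
  where the bound is attained.\<close>

lemma hankel_bound:
  fixes c1 c2 c3 x y :: complex
  assumes "cmod c1 \<le> 1" "cmod x \<le> 1" "cmod y \<le> 1"
    and c2: "c2 = (1 - c1 * cnj c1) * x"
    and c3: "c3 = (1 - c1 * cnj c1) * ((1 - x * cnj x) * y - cnj c1 * x\<^sup>2)"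
  shows "cmod (- (c1 ^ 4) / 96 - 3/16 * c1 ^ 2 * c2 + c1 * c3 / 8 - c2\<^sup>2 / 4) \<le> 1/4"
proof -
  define c r where "c = cmod c1" and "r = cmod x"
  define d e where "d = 1 - c\<^sup>2" and "e = 1 - r\<^sup>2"
  have cr: "0 \<le> c" "c \<le> 1" "0 \<le> r" "r \<le> 1" "0 \<le> d" "0 \<le> e"
    using assms by (auto simp: c_def r_def d_def e_def power_le_one)
  have cc: "c1 * cnj c1 = of_real (c\<^sup>2)" and xx: "x * cnj x = of_real (r\<^sup>2)"
    by (simp_all only: c_def r_def complex_norm_square)
  have de: "1 - c1 * cnj c1 = of_real d" "1 - x * cnj x = of_real e"
    by (simp_all add: cc xx d_def e_def)
  define t1 t2 t3 t4 t5 where "t1 = c1 ^ 4 / 96" and "t2 = 3/16 * c1 ^ 2 * (of_real d * x)"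
    and "t3 = c1 * of_real d * (of_real e * y) / 8" and "t4 = of_real (c\<^sup>2) * of_real d * x\<^sup>2 / 8"
    and "t5 = (of_real d * x)\<^sup>2 / 4"
  have "c1 * c3 / 8 = t3 - t4"
    unfolding c3 de t3_def t4_def cc[symmetric] by (simp add: field_simps)
  then have "- (c1 ^ 4) / 96 - 3/16 * c1 ^ 2 * c2 + c1 * c3 / 8 - c2\<^sup>2 / 4 = t3 - t1 - t2 - t4 - t5"
    unfolding c2 de t1_def t2_def t5_def by simp
  also have "cmod \<dots> \<le> cmod t3 + cmod t1 + cmod t2 + cmod t4 + cmod t5"
    by (intro order.trans[OF norm_triangle_ineq4] add_right_mono order.refl)
  also have "\<dots> \<le> c * d * e / 8 + c ^ 4 / 96 + 3/16 * c\<^sup>2 * (d * r) + c\<^sup>2 * d * r\<^sup>2 / 8 + d\<^sup>2 * r\<^sup>2 / 4"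
  proof -
    have "cmod t3 = c * d * e * cmod y / 8"
      using cr by (simp add: t3_def norm_mult norm_divide c_def)
    also have "\<dots> \<le> c * d * e / 8"
      using cr assms(3) by (simp add: mult_left_le)
    finally have "cmod t3 \<le> c * d * e / 8" .
    moreover have "cmod t1 = c ^ 4 / 96" "cmod t2 = 3/16 * c\<^sup>2 * (d * r)"
      "cmod t4 = c\<^sup>2 * d * r\<^sup>2 / 8" "cmod t5 = d\<^sup>2 * r\<^sup>2 / 4"
      using cr by (simp_all add: t1_def t2_def t4_def t5_def norm_mult norm_divide norm_power
          c_def r_def power_mult_distrib)
    ultimately show ?thesis by simp
  qed
  also have "\<dots> \<le> 1/4"
    using schur_parameter_bound[OF cr(1-4)] by (simp add: d_def e_def)
  finally show ?thesis .
qed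

section \<open>From the inverse function to the coefficients of the Schwarz function\<close>

text \<open>The identity \<open>g (f z) = z\<close>, read as a composition of power series, is
  solved recursively for the coefficients of the inverse up to order four.\<close>

lemma H22_inverse_on_disc:
  assumes f: "f \<in> class_S" and F: "f has_fps_expansion F"
  shows "H22 (inverse_on_disc f) = fps_nth F 2 ^ 4 - fps_nth F 2 ^ 2 * fps_nth F 3
           + fps_nth F 2 * fps_nth F 4 - fps_nth F 3 ^ 2"
proof -
  have hol: "f holomorphic_on \<D>" and inj: "inj_on f \<D>" and f0: "f 0 = 0" and f1: "deriv f 0 = 1"
    using f by (auto simp: class_S_def)
  define g where "g = inverse_on_disc f"
  have gf: "g (f z) = z" if "z \<in> \<D>" for z
    using that inj by (simp add: g_def inverse_on_disc_def the_inv_into_f_f)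
  \<comment> \<open>\<open>the_inv_into\<close> is unspecified off the image, but on this open
    neighbourhood of 0 it agrees with the holomorphic inverse and so has a Taylor expansion
    there.\<close>
  obtain h where h: "h holomorphic_on f ` \<D>" "\<And>z. z \<in> \<D> \<Longrightarrow> h (f z) = z"
    using holomorphic_has_inverse[OF hol _ inj] by (metis open_ball)
  have g_hol: "g holomorphic_on f ` \<D>"
    by (rule holomorphic_transform[OF h(1)]) (use h(2) gf in force)
  have "open (f ` \<D>)" "0 \<in> f ` \<D>"
    using open_mapping_thm3[OF hol _ inj] f0 by (auto intro!: image_eqI[of _ _ 0])
  then have G: "g has_fps_expansion fps_expansion g 0"
    using g_hol by (intro has_fps_expansion_fps_expansion)
  define G where "G = fps_expansion g 0"
  have F0: "fps_nth F 0 = 0"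
    using has_fps_expansion_imp_0_eq_fps_nth_0[OF F] f0 by simp
  have F1: "fps_nth F 1 = 1"
    using has_fps_expansion_imp_0_eq_fps_nth_0[OF has_fps_expansion_deriv[OF F]] f1 by simp
  have "fps_compose G F = fps_X"
    unfolding G_def using gf
    by (intro fps_eqI_disc[OF has_fps_expansion_compose[OF G F F0] has_fps_expansion_fps_X]) simp
  then have *: "fps_nth (fps_compose G F) n = fps_nth fps_X n" for n
    by simp
  have G1: "fps_nth G 1 = 1"
    using *[of 1] F1 by (simp add: fps_compose_nth F0)
  have G2: "fps_nth G 2 = - fps_nth F 2"
    using *[of 2] F1 G1 by (simp add: fps_compose_nth F0 fps_mult_nth eval_nat_numeral eq_neg_iff_add_eq_0 add_ac)
  have G3: "fps_nth G 3 = 2 * fps_nth F 2 ^ 2 - fps_nth F 3"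
    using *[of 3] F1 G1 G2 by (simp add: fps_compose_nth F0 fps_mult_nth eval_nat_numeral) algebra
  have G4: "fps_nth G 4 = - 5 * fps_nth F 2 ^ 3 + 5 * fps_nth F 2 * fps_nth F 3 - fps_nth F 4"
    using *[of 4] F1 G1 G2 G3 by (simp add: fps_compose_nth F0 fps_mult_nth eval_nat_numeral) algebra
  show ?thesis
    unfolding H22_def taylor_coeff_def g_def[symmetric] G_def[symmetric] G2 G3 G4
    by algebra
qed

text \<open>Multiplied out, the equation reads \<open>2 z f'(z) = (f(z) - f(-z)) exp (w(z))\<close>.
  The difference keeps only the odd coefficients of \<open>f\<close>, doubled, so each comparison is
  a linear equation for one new coefficient.\<close>

lemma coeffs_of_subordination:
  assumes f: "f \<in> class_S" and F: "f has_fps_expansion F" and W: "w has_fps_expansion W" and w0: "w 0 = 0"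
    and eq: "\<forall>z\<in>\<D>. sym_quotient f z = exp (w z)"
  shows "fps_nth F 2 = fps_nth W 1 / 2"
    and "fps_nth F 3 = fps_nth W 2 / 2 + fps_nth W 1 ^ 2 / 4"
    and "fps_nth F 4 = fps_nth W 3 / 4 + 3/8 * fps_nth W 1 * fps_nth W 2 + 5/48 * fps_nth W 1 ^ 3"
proof -
  have inj: "inj_on f \<D>" and f0: "f 0 = 0" and f1: "deriv f 0 = 1"
    using f by (auto simp: class_S_def)
  have W0: "fps_nth W 0 = 0"
    using has_fps_expansion_imp_0_eq_fps_nth_0[OF W] w0 by simp
  have F0: "fps_nth F 0 = 0"
    using has_fps_expansion_imp_0_eq_fps_nth_0[OF F] f0 by simp
  have F1: "fps_nth F 1 = 1"
    using has_fps_expansion_imp_0_eq_fps_nth_0[OF has_fps_expansion_deriv[OF F]] f1 by simp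
  define E where "E = fps_compose (fps_exp 1) W"
  have E: "(exp \<circ> w) has_fps_expansion E"
    unfolding E_def by (intro has_fps_expansion_compose W W0 has_fps_expansion_exp1)
  have F': "(f \<circ> uminus) has_fps_expansion fps_compose F (- fps_X)"
    by (intro has_fps_expansion_compose F fps_expansion_intros) auto
  have L: "(\<lambda>z. 2 * z * deriv f z) has_fps_expansion fps_const 2 * fps_X * fps_deriv F"
    by (intro fps_expansion_intros F)
  have R: "(\<lambda>z. (f z - (f \<circ> uminus) z) * (exp \<circ> w) z) has_fps_expansion (F - fps_compose F (- fps_X)) * E"
    by (intro fps_expansion_intros F F' E)
  have "fps_const 2 * fps_X * fps_deriv F = (F - fps_compose F (- fps_X)) * E"
  proof (rule fps_eqI_disc[OF L R])
    fix z assume z: "z \<in> \<D>"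
    show "2 * z * deriv f z = (f z - (f \<circ> uminus) z) * (exp \<circ> w) z"
    proof (cases "z = 0")
      case False
      \<comment> \<open>univalence keeps the quotient clear of division by zero\<close>
      then have "f z \<noteq> f (- z)"
        using inj_onD[OF inj, of z "- z"] z by auto
      then show ?thesis
        using bspec[OF eq z] False by (auto simp: sym_quotient_def field_simps)
    qed simp
  qed
  then have *: "fps_nth (fps_const 2 * fps_X * fps_deriv F) n = fps_nth ((F - fps_compose F (- fps_X)) * E) n" for n
    by simp
  have E_nth: "fps_nth E 0 = 1" "fps_nth E 1 = fps_nth W 1"
    "fps_nth E 2 = fps_nth W 2 + fps_nth W 1 ^ 2 / 2"
    "fps_nth E 3 = fps_nth W 3 + fps_nth W 1 * fps_nth W 2 + fps_nth W 1 ^ 3 / 6"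
    by (simp_all add: E_def fps_compose_nth W0 fps_mult_nth eval_nat_numeral field_simps)
  have "2 * fps_nth F 2 = fps_nth E 1"
    using *[of 2] E_nth(1) F0 F1 by (simp add: fps_compose_uminus' fps_mult_nth eval_nat_numeral)
  then show "fps_nth F 2 = fps_nth W 1 / 2"
    unfolding E_nth by (simp add: field_simps)
  have "2 * fps_nth F 3 = fps_nth E 2"
    using *[of 3] E_nth(1) F0 F1 by (simp add: fps_compose_uminus' fps_mult_nth eval_nat_numeral field_simps)
  then show F3: "fps_nth F 3 = fps_nth W 2 / 2 + fps_nth W 1 ^ 2 / 4"
    unfolding E_nth by (simp add: field_simps)
  have "2 * (4 * fps_nth F 4) = 2 * (fps_nth E 3 + fps_nth F 3 * fps_nth E 1)"
    using *[of 4] E_nth(1) F0 F1 by (simp add: fps_compose_uminus' fps_mult_nth eval_nat_numeral field_simps)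
  then have F4: "fps_nth F 4 = (fps_nth E 3 + fps_nth F 3 * fps_nth E 1) / 4"
    unfolding mult_cancel_left by (simp add: field_simps)
  show "fps_nth F 4 = fps_nth W 3 / 4 + 3/8 * fps_nth W 1 * fps_nth W 2 + 5/48 * fps_nth W 1 ^ 3"
    unfolding F4 E_nth F3 by (simp add: field_simps power2_eq_square power3_eq_cube)
qed

text \<open>This formula serves both the bound, for general \<open>w\<close>, and sharpness, for
  \<open>w(z) = z^2\<close>.\<close>

lemma H22_subordination:
  assumes "f \<in> class_S" "w has_fps_expansion W" "w 0 = 0"
    and "\<forall>z\<in>\<D>. sym_quotient f z = exp (w z)"
  shows "H22 (inverse_on_disc f) = - (fps_nth W 1 ^ 4) / 96 - 3/16 * fps_nth W 1 ^ 2 * fps_nth W 2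
     + fps_nth W 1 * fps_nth W 3 / 8 - (fps_nth W 2)\<^sup>2 / 4"
proof -
  have F: "f has_fps_expansion fps_expansion f 0"
    using assms(1) by (intro fps_expansion_disc) (simp add: class_S_def)
  show ?thesis
    unfolding H22_inverse_on_disc[OF assms(1) F] coeffs_of_subordination[OF assms(1) F assms(2-4)]
    by (simp add: field_simps eval_nat_numeral)
qed

section \<open>Construction of the extremal function\<close>

text \<open>The Noshiro-Warschawski criterion: along the segment joining two points with equal
  values, a suitable real part would be strictly increasing and yet agree at both ends.\<close>

lemma injective_of_Re_deriv_pos:
  assumes S: "convex S" and der: "\<And>s. s \<in> S \<Longrightarrow> (L has_field_derivative L' s) (at s)"
    and pos: "\<And>s. s \<in> S \<Longrightarrow> Re (L' s) > 0"
  shows "inj_on L S"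
proof (rule inj_onI, rule ccontr)
  fix s t assume st: "s \<in> S" "t \<in> S" "L s = L t" "s \<noteq> t"
  define p where "p x = s + of_real x * (t - s)" for x :: real
  \<comment> \<open>Dividing by \<open>t - s\<close> cancels the velocity of \<open>p\<close>, so
    that \<open>g\<close> has derivative \<open>Re (L' (p x))\<close>.\<close>
  define g where "g x = Re (L (p x) / (t - s))" for x
  have p: "p x \<in> S" if "0 \<le> x" "x \<le> 1" for x
    using convexD_alt[OF S st(1,2) that] by (simp add: p_def scaleR_conv_of_real algebra_simps)
  have "(g has_real_derivative Re (L' (p x))) (at x)" if "0 \<le> x" "x \<le> 1" for x
  proof -
    have "(p has_vector_derivative (t - s)) (at x)"
      unfolding p_def by (auto intro!: derivative_eq_intros)
    from field_vector_diff_chain_at[OF this der[OF p[OF that]]]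
    have "((\<lambda>x. L (p x)) has_vector_derivative (t - s) * L' (p x)) (at x)"
      by (simp add: o_def)
    then have "((\<lambda>x. L (p x) / (t - s)) has_vector_derivative (t - s) * L' (p x) / (t - s)) (at x)"
      by (rule has_vector_derivative_divide)
    then have "((\<lambda>x. L (p x) / (t - s)) has_vector_derivative L' (p x)) (at x)"
      using st(4) by simp
    then have "(g has_vector_derivative Re (L' (p x))) (at x)"
      unfolding g_def by (rule bounded_linear.has_vector_derivative[OF bounded_linear_Re])
    then show ?thesis
      by (simp add: has_real_derivative_iff_has_vector_derivative)
  qed
  then have "\<exists>y. (g has_real_derivative y) (at x) \<and> 0 < y" if "0 \<le> x" "x \<le> 1" for x
    using pos[OF p[OF that]] that by blast
  then have "g 0 < g 1"
    by (rule DERIV_pos_imp_increasing[OF zero_less_one])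
  then show False
    using st(3) by (simp add: g_def p_def)
qed

text \<open>Evenness of \<open>h\<close> makes \<open>f\<close> odd, so the symmetric quotient
  reduces to \<open>z f'(z) / f(z) = 1 + z h'(z) = exp (z^2)\<close> away from 0.\<close>

lemma extremal_function:
  obtains f where "f \<in> class_S" "\<forall>z\<in>\<D>. sym_quotient f z = exp (z\<^sup>2)"
proof -
  \<comment> \<open>The value 0 fills the removable singularity: it is the derivative of the
    numerator at 0.\<close>
  define q where "q z = (if z = 0 then 0 else (exp (z\<^sup>2) - 1) / z)" for z :: complex
  have d0: "deriv (\<lambda>z::complex. exp (z\<^sup>2) - 1) 0 = 0"
    by (rule DERIV_imp_deriv) (auto intro!: derivative_eq_intros)
  have q: "q holomorphic_on \<D>"
    by (rule pole_theorem_open_0[of "\<lambda>z. exp (z\<^sup>2) - 1" _ 0])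
       (auto simp: q_def d0 intro!: holomorphic_intros)
  obtain h0 where h0: "\<And>z. z \<in> \<D> \<Longrightarrow> (h0 has_field_derivative q z) (at z within \<D>)"
    using holomorphic_convex_primitive'[OF convex_ball open_ball q] by blast
  \<comment> \<open>The normalisation \<open>h 0 = 0\<close> gives
    \<open>deriv f 0 = 1\<close>.\<close>
  define h where "h z = h0 z - h0 0" for z
  have h: "(h has_field_derivative q z) (at z)" if "z \<in> \<D>" for z
    using h0[OF that] that at_within_open[OF that open_ball] unfolding h_def
    by (auto intro!: derivative_eq_intros)
  \<comment> \<open>A primitive of the odd function \<open>q\<close> is even.\<close>
  have h_even: "h (- z) = h z" if "z \<in> \<D>" for z
  proof -
    have "((\<lambda>z. h (- z) - h z) has_field_derivative 0) (at u within \<D>)" if u: "u \<in> \<D>" for u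
    proof -
      have "((\<lambda>z. h (- z)) has_field_derivative q (- u) * (- 1)) (at u)"
        using h[of "- u"] u
        by (intro DERIV_chain2[where f = h and g = uminus]) (auto intro!: derivative_eq_intros)
      then have "((\<lambda>z. h (- z) - h z) has_field_derivative q (- u) * (- 1) - q u) (at u)"
        by (intro DERIV_diff h u)
      moreover have "q (- u) * (- 1) - q u = 0"
        by (simp add: q_def)
      ultimately show ?thesis
        by (metis has_field_derivative_at_within)
    qed
    from has_field_derivative_zero_constant[OF convex_ball this]
    obtain c where "\<And>z. z \<in> \<D> \<Longrightarrow> h (- z) - h z = c"
      by blast
    from this[of 0] this[OF that] show ?thesis by simp
  qed
  define f where "f z = z * exp (h z)" for z
  have f_deriv: "(f has_field_derivative exp (z\<^sup>2) * exp (h z)) (at z)" if "z \<in> \<D>" for z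
  proof -
    have "(f has_field_derivative exp (h z) + z * (exp (h z) * q z)) (at z)"
      unfolding f_def by (auto intro!: derivative_eq_intros h that)
    moreover have "exp (h z) + z * (exp (h z) * q z) = exp (z\<^sup>2) * exp (h z)"
      by (auto simp: q_def field_simps)
    ultimately show ?thesis by simp
  qed
  have f_nz: "f z \<noteq> 0" if "z \<noteq> 0" for z
    using that by (simp add: f_def)
  define L where "L s = s + h (exp s)" for s
  have f_exp: "f (exp s) = exp (L s)" for s
    by (simp add: f_def L_def exp_add)
  have L_inj: "inj_on L {s. Re s < 0}"
  proof (rule injective_of_Re_deriv_pos)
    show "convex {s. Re s < 0}"
      by (rule convex_halfspace_Re_lt)
    fix s assume "s \<in> {s. Re s < 0}"
    then have s: "exp s \<in> \<D>"
      by simp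
    have "(L has_field_derivative 1 + q (exp s) * exp s) (at s)"
      unfolding L_def by (auto intro!: derivative_eq_intros DERIV_chain2[where f = h and g = exp] h s)
    then show "(L has_field_derivative exp ((exp s)\<^sup>2)) (at s)"
      by (simp add: q_def)
    \<comment> \<open>The real part of \<open>exp u\<close> has the sign of
      \<open>cos (Im u)\<close>, so an imaginary part below \<open>pi / 2\<close> in modulus
      suffices.\<close>
    have "\<bar>Im ((exp s)\<^sup>2)\<bar> \<le> cmod ((exp s)\<^sup>2)"
      by (rule abs_Im_le_cmod)
    also have "\<dots> < 1"
      using s by (simp add: norm_power power_less_one_iff)
    also have "1 < pi / 2"
      using pi_gt3 by simp
    finally have "0 < cos (Im ((exp s)\<^sup>2))"
      by (intro cos_gt_zero_pi) auto
    then show "0 < Re (exp ((exp s)\<^sup>2))"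
      by (simp add: Re_exp)
  qed
  have f_inj: "inj_on f \<D>"
  proof (rule inj_onI)
    fix z u assume zu: "z \<in> \<D>" "u \<in> \<D>" "f z = f u"
    show "z = u"
    proof (cases "z = 0 \<or> u = 0")
      case True
      then show ?thesis
        using zu(3) f_nz by (metis f_def mult_zero_left)
    next
      case False
      define s t where "s = Ln z" and "t = Ln u"
      have exp: "exp s = z" "exp t = u"
        using False by (simp_all add: s_def t_def)
      then have "Re s < 0" "Re t < 0"
        using zu by (metis exp_less_one_iff mem_ball_0 norm_exp_eq_Re)+
      have "exp (L s) = exp (L t)"
        using zu(3) by (simp add: f_exp[symmetric] exp)
      then obtain n :: int where n: "L s = L t + of_int (2 * n) * pi * \<i>"
        by (auto simp: exp_eq)
      \<comment> \<open>The period is absorbed into \<open>t\<close>: since \<open>h (exp s)\<close>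
        is periodic, \<open>L\<close> shifts by the same amount, and the real part of
        \<open>t\<close> is unchanged.\<close>
      define t' where "t' = t + of_int (2 * n) * pi * \<i>"
      have t': "exp t' = exp t"
        unfolding t'_def exp_eq by blast
      then have "L s = L t'"
        using n by (simp add: L_def t'_def)
      moreover have "Re t' = Re t"
        by (simp add: t'_def)
      ultimately have "s = t'"
        using inj_onD[OF L_inj, of s t'] \<open>Re s < 0\<close> \<open>Re t < 0\<close> by simp
      then show ?thesis
        using t' exp by simp
    qed
  qed
  show ?thesis
  proof (rule that)
    have "h 0 = 0" by (simp add: h_def)
    then have "deriv f 0 = 1"
      using DERIV_imp_deriv[OF f_deriv[of 0]] by simp
    moreover have "f holomorphic_on \<D>"
      using f_deriv by (force simp: holomorphic_on_open)
    ultimately show "f \<in> class_S"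
      using f_inj by (simp add: class_S_def f_def)
    have "sym_quotient f z = exp (z\<^sup>2)" if z: "z \<in> \<D>" for z
    proof -
      have "f z - f (- z) = 2 * z * exp (h z)"
        using h_even[OF z] by (simp add: f_def)
      then show ?thesis
        using DERIV_imp_deriv[OF f_deriv[OF z]] by (simp add: sym_quotient_def)
    qed
    then show "\<forall>z\<in>\<D>. sym_quotient f z = exp (z\<^sup>2)"
      by blast
  qed
qed

section \<open>The bound and its attainment\<close>

theorem theorem2p5:
  shows "(\<forall>f\<in>class_SSe. cmod (H22 (inverse_on_disc f)) \<le> 1 / 4) \<and>
         (\<exists>f\<in>class_SSe. cmod (H22 (inverse_on_disc f)) = 1 / 4)"
proof (intro conjI ballI)
  fix f assume "f \<in> class_SSe"
  then obtain w where f: "f \<in> class_S" and w: "w holomorphic_on \<D>" "w \<in> \<D> \<rightarrow> \<D>" "w 0 = 0"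
    "\<forall>z\<in>\<D>. sym_quotient f z = exp (w z)"
    unfolding class_SSe_def subordinate_def by blast
  note W = fps_expansion_disc[OF w(1)]
  obtain x y where "cmod (fps_nth (fps_expansion w 0) 1) \<le> 1" "cmod x \<le> 1" "cmod y \<le> 1"
    "fps_nth (fps_expansion w 0) 2 = (1 - fps_nth (fps_expansion w 0) 1 * cnj (fps_nth (fps_expansion w 0) 1)) * x"
    "fps_nth (fps_expansion w 0) 3 = (1 - fps_nth (fps_expansion w 0) 1 * cnj (fps_nth (fps_expansion w 0) 1))
       * ((1 - x * cnj x) * y - cnj (fps_nth (fps_expansion w 0) 1) * x\<^sup>2)"
    by (rule schur_coeffs[OF w(1-3) W])
  then show "cmod (H22 (inverse_on_disc f)) \<le> 1 / 4"
    unfolding H22_subordination[OF f W w(3,4)] by (rule hankel_bound)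
next
  obtain f where f: "f \<in> class_S" and eq: "\<forall>z\<in>\<D>. sym_quotient f z = exp (z\<^sup>2)"
    by (rule extremal_function)
  have "(\<lambda>z. exp (z\<^sup>2)) holomorphic_on \<D>"
    by (intro holomorphic_intros)
  \<comment> \<open>The value 1 at the origin in \<open>sym_quotient\<close> makes the agreement
    with \<open>exp (z\<^sup>2)\<close> hold on the whole disc.\<close>
  then have "sym_quotient f holomorphic_on \<D>"
    using eq by (metis holomorphic_transform)
  moreover have "(\<lambda>z::complex. z\<^sup>2) \<in> \<D> \<rightarrow> \<D>"
    by (auto simp: norm_power power_less_one_iff)
  ultimately have "f \<in> class_SSe"
    using f eq unfolding class_SSe_def subordinate_def
    by (auto intro!: holomorphic_intros exI[of _ "\<lambda>z. z\<^sup>2"])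
  \<comment> \<open>For \<open>w(z) = z^2\<close> only the second coefficient survives, leaving the
    term \<open>- c2^2 / 4\<close> with \<open>c2 = 1\<close>.\<close>
  moreover have "H22 (inverse_on_disc f) = - 1/4"
    using H22_subordination[OF f has_fps_expansion_fps_X_power[of 2] _ eq] by simp
  ultimately show "\<exists>f\<in>class_SSe. cmod (H22 (inverse_on_disc f)) = 1 / 4"
    by (intro bexI[of _ f]) (simp_all add: norm_divide)
qed

end
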